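(* For every integer $k \geq 2$ we have $\left\lceil\frac{k}{2}\right\rceil \leq w_k \leq \left\lceil\frac{k}{2}\right\rceil+1$.
   Context: Let $k\ge 1$ be an integer. For a point $p\in\mathbb{R}^2$ and $i=0,\dots,k-1$, let $\ell_i(p)$ be the ray from $p$ in direction $(\cos(2\pi i/k),\sin(2\pi i/k))$. These $k$ rays (the sector-bounding rays of $p$) divide the plane around $p$ into $k$ equal sectors $s_0(p),\dots,s_{k-1}(p)$, where $s_i(p)$ is the sector bounded by $\ell_i(p)$ and the next ray $\ell_{i+1}(p)$ counterclockwise (indices mod $k$). All point sets are finite and in general position (with respect to $k$): no point of the set lies on a sector-bounding ray of another point of the set, and there are no three distinct points $p,q,q'$ in the set such that $q,q'$ lie in the same sector of $p$ and are at the same Euclidean distance from $p$. Given a point set $P$ and a linear order $p_1,\dots,p_n$ of $P$, the corresponding $k$-sector ordered Yao graph is the directed graph on $P$ in which, for every $j$ and every $i$ such that the sector $s_i(p_j)$ contains at least one of the predecessors $p_1,\dots,p_{j-1}$, there is exactly one edge from $p_j$ to its closest (in Euclidean distance) predecessor in $s_i(p_j)$; there are no other edges. A clique in this graph is a set of pairwise adjacent vertices, where the orientation of edges is ignored. $w_k(n)$ is the maximum integer for which there exists an $n$-point set in the plane such that for every order, the corresponding $k$-sector ordered Yao graph contains a clique of size $w_k(n)$, and $w_k=\max_n w_k(n)$. Equivalently, $w_k$ is the maximum integer for which there exists a (finite) point set in the plane such that for every order, the corresponding $k$-sector ordered Yao graph contains a clique of size $w_k$. *)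

theory Defs
  imports "HOL-Analysis.Analysis"
begin

definition unit_dir :: "real \<Rightarrow> real^2" where
  "unit_dir \<theta> = vector [cos \<theta>, sin \<theta>]"

definition bounding_ray :: "nat \<Rightarrow> nat \<Rightarrow> real^2 \<Rightarrow> (real^2) set" where
  "bounding_ray k i p = {p + t *\<^sub>R unit_dir (2 * pi * real i / real k) | t. t \<ge> 0}"

text \<open>Sectors are taken to be open. Whether the bounding rays are included is immaterial for
  point sets in general position, because no point lies on a bounding ray of another one.
  Using \<^term>\<open>i + 1\<close> as an angle index (instead of its residue modulo \<^term>\<open>k\<close>) gives the
  correct last sector, and for \<^term>\<open>k = 1\<close> the plane without the only ray.\<close>

definition sector :: "nat \<Rightarrow> nat \<Rightarrow> real^2 \<Rightarrow> (real^2) set" where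
  "sector k i p = {p + r *\<^sub>R unit_dir \<theta> | r \<theta>.
     r > 0 \<and> 2 * pi * real i / real k < \<theta> \<and> \<theta> < 2 * pi * real (i + 1) / real k}"

definition general_position :: "nat \<Rightarrow> (real^2) set \<Rightarrow> bool" where
  "general_position k P \<longleftrightarrow>
     (\<forall>p\<in>P. \<forall>q\<in>P. p \<noteq> q \<longrightarrow> (\<forall>i<k. q \<notin> bounding_ray k i p)) \<and>
     (\<forall>p\<in>P. \<forall>q\<in>P. \<forall>q'\<in>P. p \<noteq> q \<and> p \<noteq> q' \<and> q \<noteq> q' \<longrightarrow>
        (\<forall>i<k. q \<in> sector k i p \<and> q' \<in> sector k i p \<longrightarrow> dist p q \<noteq> dist p q'))"

text \<open>A linear order of a finite set is given by a duplicate-free list enumerating it.\<close>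

definition orders :: "'a set \<Rightarrow> 'a list set" where
  "orders P = {ps. distinct ps \<and> set ps = P}"

definition ordered_yao_graph :: "nat \<Rightarrow> (real^2) list \<Rightarrow> ((real^2) \<times> (real^2)) set" where
  "ordered_yao_graph k ps = {(ps ! j, q) | j q. j < length ps \<and>
     (\<exists>i<k. is_arg_min (dist (ps ! j)) (\<lambda>x. x \<in> set (take j ps) \<inter> sector k i (ps ! j)) q)}"

definition clique :: "'a set \<Rightarrow> ('a \<times> 'a) set \<Rightarrow> 'a set \<Rightarrow> bool" where
  "clique V E C \<longleftrightarrow> C \<subseteq> V \<and> (\<forall>u\<in>C. \<forall>v\<in>C. u \<noteq> v \<longrightarrow> (u, v) \<in> E \<or> (v, u) \<in> E)"

definition unavoidable_clique_size :: "nat \<Rightarrow> (real^2) set \<Rightarrow> nat \<Rightarrow> bool" where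
  "unavoidable_clique_size k P m \<longleftrightarrow>
     (\<forall>ps\<in>orders P. \<exists>C. clique P (ordered_yao_graph k ps) C \<and> card C = m)"

definition yao_w_sizes :: "nat \<Rightarrow> nat \<Rightarrow> nat set" where
  "yao_w_sizes k n = {m. \<exists>P. finite P \<and> card P = n \<and> general_position k P \<and>
                       unavoidable_clique_size k P m}"

definition yao_w_n :: "nat \<Rightarrow> nat \<Rightarrow> nat" where
  "yao_w_n k n = Max (yao_w_sizes k n)"

text \<open>\<^const>\<open>Max\<close> is a genuine maximum only for a finite nonempty set. For \<^const>\<open>yao_w_n\<close> this
  is shown below. For the maximum over all \<open>n\<close> it is not clear a priori, so results about
  \<open>yao_w\<close> should also establish finiteness of the range.\<close>

definition yao_w :: "nat \<Rightarrow> nat" where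
  "yao_w k = Max (range (yao_w_n k))"

lemma ordered_yao_graph_unique:
  assumes "general_position k (set ps)" "distinct ps" "j < length ps" "i < k"
    and "set (take j ps) \<inter> sector k i (ps ! j) \<noteq> {}"
  shows "\<exists>!q. is_arg_min (dist (ps ! j)) (\<lambda>x. x \<in> set (take j ps) \<inter> sector k i (ps ! j)) q"
proof -
  let ?S = "set (take j ps) \<inter> sector k i (ps ! j)"
  have pj: "x \<in> set ps \<and> x \<noteq> ps ! j" if x: "x \<in> ?S" for x
  proof -
    obtain l where "l < j" "x = ps ! l"
      using x assms(3) by (auto simp: in_set_conv_nth)
    with assms(2,3) show ?thesis by (simp add: nth_eq_iff_index_eq)
  qed
  obtain q where q: "is_arg_min (dist (ps ! j)) (\<lambda>x. x \<in> ?S) q"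
    using ex_is_arg_min_if_finite[OF _ assms(5)] by blast
  show ?thesis
  proof (rule ex1I)
    show "is_arg_min (dist (ps ! j)) (\<lambda>x. x \<in> ?S) q" by (fact q)
  next
    fix q' assume q': "is_arg_min (dist (ps ! j)) (\<lambda>x. x \<in> ?S) q'"
    have mem: "q \<in> ?S" "q' \<in> ?S"
      using q q' by (simp_all only: is_arg_min_def)
    have "\<not> dist (ps ! j) q' < dist (ps ! j) q"
      using q mem(2) by (simp add: is_arg_min_def)
    moreover have "\<not> dist (ps ! j) q < dist (ps ! j) q'"
      using q' mem(1) by (simp add: is_arg_min_def)
    ultimately have eq: "dist (ps ! j) q = dist (ps ! j) q'" by linarith
    have gp: "dist p a \<noteq> dist p b"
      if "p \<in> set ps" "a \<in> set ps" "b \<in> set ps" "p \<noteq> a" "p \<noteq> b" "a \<noteq> b"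
        "a \<in> sector k i p" "b \<in> sector k i p" for p a b
      using assms(1,4) that by (simp add: general_position_def)
    have "ps ! j \<in> set ps" using assms(3) by simp
    then show "q' = q"
      using gp[of "ps ! j" q q'] eq mem pj[OF mem(1)] pj[OF mem(2)] by (metis IntD2)
  qed
qed

lemma general_position_exists:
  assumes "k \<ge> 1"
  shows "\<exists>P. finite P \<and> card P = n \<and> general_position k P"
proof -
  define e where "e = unit_dir (pi / (2 * real k))"
  define f where "f i = (3 ^ i :: real) *\<^sub>R e" for i :: nat
  have nd: "norm (unit_dir \<theta>) = 1" for \<theta>
    by (simp add: unit_dir_def norm_vec_def L2_set_def UNIV_2)
  have ne: "norm e = 1" by (simp add: e_def nd)
  have inj: "inj f"
    using ne by (auto simp: inj_on_def f_def)
  have dd: "dist (f i) (f j) = \<bar>3 ^ i - 3 ^ j\<bar>" for i j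
    using ne by (simp add: dist_norm f_def flip: scaleR_diff_left)
  have par: "sin (\<theta> - pi / (2 * real k)) = 0" if "t *\<^sub>R unit_dir \<theta> = s *\<^sub>R e" "s \<noteq> 0" for t s \<theta>
  proof -
    have a: "t * cos \<theta> = s * cos (pi / (2 * real k))" "t * sin \<theta> = s * sin (pi / (2 * real k))"
      using that(1) by (simp_all add: e_def unit_dir_def vec_eq_iff forall_2)
    have "t \<noteq> 0" using that ne by auto
    have "t * sin (\<theta> - pi / (2 * real k))
        = (t * sin \<theta>) * cos (pi / (2 * real k)) - (t * cos \<theta>) * sin (pi / (2 * real k))"
      by (simp add: sin_diff algebra_simps)
    also have "\<dots> = 0" unfolding a by simp
    finally show ?thesis using \<open>t \<noteq> 0\<close> by simp
  qed
  have noray: "f b \<notin> bounding_ray k i (f a)" if "a \<noteq> b" for a b i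
  proof
    assume "f b \<in> bounding_ray k i (f a)"
    then obtain t where "f b = f a + t *\<^sub>R unit_dir (2 * pi * real i / real k)"
      by (auto simp: bounding_ray_def)
    then have "t *\<^sub>R unit_dir (2 * pi * real i / real k) = (3 ^ b - 3 ^ a) *\<^sub>R e"
      by (simp add: f_def algebra_simps)
    from par[OF this] that have "sin (2 * pi * real i / real k - pi / (2 * real k)) = 0"
      by simp
    then obtain m :: int where "2 * pi * real i / real k - pi / (2 * real k) = of_int m * pi"
      by (auto simp: sin_zero_iff_int2)
    then have "pi * (4 * real i - 1) = pi * (2 * real k * of_int m)"
      using assms by (simp add: field_simps)
    then have "real_of_int (4 * int i - 1) = real_of_int (2 * (int k * m))"
      by simp
    then have "4 * int i - 1 = 2 * (int k * m)"
      by (simp only: of_int_eq_iff)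
    then show False by presburger
  qed
  have nodist: "dist (f a) (f b) \<noteq> dist (f a) (f c)" if "b \<noteq> c" "a \<noteq> b" "a \<noteq> c" for a b c
  proof
    assume "dist (f a) (f b) = dist (f a) (f c)"
    then have eq: "\<bar>3 ^ a - 3 ^ b :: real\<bar> = \<bar>3 ^ a - 3 ^ c\<bar>" by (simp add: dd)
    have *: "(3::real) ^ x \<ge> 3 * 3 ^ y" if "y < x" for x y :: nat
      using power_increasing[of "Suc y" x "3::real"] that by simp
    have pos: "(3::real) ^ x > 0" for x :: nat by simp
    have bc: "(3::real) ^ b \<noteq> 3 ^ c" using that by simp
    show False
    proof (cases "a < b"; cases "a < c")
      assume "a < b" "a < c"
      then show False using eq bc *[of a b] *[of a c] pos[of a] by linarith
    next
      assume "a < b" "\<not> a < c"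
      then show False using eq that(3) *[of a b] *[of c a] pos[of a] pos[of c] by linarith
    next
      assume "\<not> a < b" "a < c"
      then show False using eq that(2) *[of b a] *[of a c] pos[of a] pos[of b] by linarith
    next
      assume "\<not> a < b" "\<not> a < c"
      then show False using eq bc that(2,3) *[of b a] *[of c a] pos[of b] pos[of c] by linarith
    qed
  qed
  have "general_position k (f ` {..<n})"
    unfolding general_position_def using noray nodist by (auto simp: inj_eq[OF inj])
  moreover have "card (f ` {..<n}) = n"
    using inj by (simp add: card_image inj_on_subset)
  ultimately show ?thesis by blast
qed

lemma yao_w_sizes_finite_nonempty:
  assumes "k \<ge> 1"
  shows "finite (yao_w_sizes k n)" and "yao_w_sizes k n \<noteq> {}"
proof -
  have "m \<le> n" if m: "m \<in> yao_w_sizes k n" for m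
  proof -
    obtain P where P: "finite P" "card P = n" "unavoidable_clique_size k P m"
      using m by (auto simp: yao_w_sizes_def)
    obtain ps where "ps \<in> orders P"
      using finite_distinct_list[OF P(1)] by (auto simp: orders_def)
    then obtain C where "C \<subseteq> P" "card C = m"
      using P(3) by (auto simp: unavoidable_clique_size_def clique_def)
    then show ?thesis using P card_mono by blast
  qed
  then show "finite (yao_w_sizes k n)"
    by (meson finite_nat_set_iff_bounded_le)
  obtain P where P: "finite P" "card P = n" "general_position k P"
    using general_position_exists[OF assms] by blast
  have "unavoidable_clique_size k P 0"
    unfolding unavoidable_clique_size_def clique_def
    by (intro ballI exI[of _ "{}"]) auto
  with P have "0 \<in> yao_w_sizes k n" by (auto simp: yao_w_sizes_def)
  then show "yao_w_sizes k n \<noteq> {}" by blast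
qed

end

theory Submission imports Defs begin

text \<open>
  Let \<open>m = \<lceil>k / 2\<rceil>\<close>.

  Upper bound. Order a point set by increasing second coordinate; general position excludes ties,
  since a point at the same height would lie on the horizontal ray \<open>\<ell>\<^sub>0\<close> of one of the two. All
  predecessors of a point then lie strictly below it, and the open lower half-plane meets only
  \<open>m\<close> of the \<open>k\<close> sectors. So every out-degree is at most \<open>m\<close>
  (\<open>out_degree_le_of_sorted_by_height\<close>). In a clique the last vertex sends an edge to every other
  one, hence no clique has more than \<open>m + 1\<close> vertices.

  Lower bound. If every point of a set sees all the others in pairwise different sectors, then any
  other point is automatically the closest one in its sector, so every order produces a complete
  graph (\<open>clique_if_separated\<close>). It remains to find \<open>m\<close> points with this property: take every
  second vertex of a suitably rotated regular \<open>k\<close>-gon. The chord joining the vertices with central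
  angles \<open>\<alpha>\<close> and \<open>\<beta>\<close> is orthogonal to the direction \<open>(\<alpha> + \<beta>) / 2\<close>, so, seen from a fixed vertex,
  consecutive other vertices differ in direction by exactly one sector width \<open>2 * pi / k\<close>. The only
  exception is the passage from the last vertex to the first one when \<open>k\<close> is odd: these two are
  adjacent in the \<open>k\<close>-gon and differ by half a sector width. The rotation puts directions before
  this step three quarters of the way through their sector, so that half a width more still leads
  into the next sector.
\<close>

section \<open>Directions and sectors\<close>

lemma unit_dir_nth [simp]: "unit_dir \<theta> $ 1 = cos \<theta>" "unit_dir \<theta> $ 2 = sin \<theta>"
  by (simp_all add: unit_dir_def)

lemma norm_unit_dir [simp]: "norm (unit_dir \<theta>) = 1"
  by (simp add: norm_vec_def L2_set_def UNIV_2)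

lemma unit_dir_add_pi: "unit_dir (\<theta> + pi) = - unit_dir \<theta>"
  by (simp add: vec_eq_iff forall_2)

lemma unit_dir_eq_iff: "unit_dir \<theta> = unit_dir \<phi> \<longleftrightarrow> (\<exists>n::int. \<phi> = \<theta> + 2 * pi * n)"
  using sin_cos_eq_iff[of \<phi> \<theta>] by (auto simp: vec_eq_iff forall_2 eq_commute)

lemma scaleR_unit_dir_eq_iff:
  assumes "r > 0" "t \<ge> 0"
  shows "r *\<^sub>R unit_dir \<theta> = t *\<^sub>R unit_dir \<phi> \<longleftrightarrow> r = t \<and> unit_dir \<theta> = unit_dir \<phi>"
proof
  assume eq: "r *\<^sub>R unit_dir \<theta> = t *\<^sub>R unit_dir \<phi>"
  then have "norm (r *\<^sub>R unit_dir \<theta>) = norm (t *\<^sub>R unit_dir \<phi>)" by simp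
  then have "r = t" using assms by simp
  then show "r = t \<and> unit_dir \<theta> = unit_dir \<phi>" using eq assms by simp
qed simp

text \<open>Measuring angles in sector widths \<open>2 * pi / k\<close> reduces membership in rays and sectors to
  arithmetic modulo \<open>k\<close>.\<close>

lemma mem_bounding_ray_iff:
  assumes "k > 0" "r > 0"
  shows "p + r *\<^sub>R unit_dir (2 * pi * x / real k) \<in> bounding_ray k i p \<longleftrightarrow>
         (\<exists>n::int. real i = x + real k * n)"
proof -
  have "p + r *\<^sub>R unit_dir (2 * pi * x / real k) \<in> bounding_ray k i p \<longleftrightarrow>
      unit_dir (2 * pi * x / real k) = unit_dir (2 * pi * real i / real k)"
    using assms(2) by (auto simp: bounding_ray_def scaleR_unit_dir_eq_iff)
  also have "\<dots> \<longleftrightarrow> (\<exists>n::int. 2 * pi * real i / real k = 2 * pi * x / real k + 2 * pi * n)"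
    by (rule unit_dir_eq_iff)
  also have "\<dots> \<longleftrightarrow> (\<exists>n::int. real i = x + real k * n)"
  proof (intro ex_cong1)
    fix n :: int
    have "2 * pi * x / real k + 2 * pi * n = 2 * pi * (x + real k * n) / real k"
      using assms(1) by (simp add: field_simps)
    then show "(2 * pi * real i / real k = 2 * pi * x / real k + 2 * pi * n)
        = (real i = x + real k * n)"
      using assms(1) by simp
  qed
  finally show ?thesis .
qed

lemma mem_sector_iff:
  assumes "k > 0" "r > 0"
  shows "p + r *\<^sub>R unit_dir (2 * pi * x / real k) \<in> sector k i p \<longleftrightarrow>
         (\<exists>n::int. real i < x + real k * n \<and> x + real k * n < real i + 1)"
proof -
  have "p + r *\<^sub>R unit_dir (2 * pi * x / real k) \<in> sector k i p \<longleftrightarrow>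
      (\<exists>\<phi>. unit_dir (2 * pi * x / real k) = unit_dir \<phi> \<and>
        2 * pi * real i / real k < \<phi> \<and> \<phi> < 2 * pi * real (i + 1) / real k)"
    using assms(2) by (auto simp: sector_def scaleR_unit_dir_eq_iff) blast
  also have "\<dots> \<longleftrightarrow> (\<exists>n::int.
      2 * pi * real i / real k < 2 * pi * x / real k + 2 * pi * n \<and>
      2 * pi * x / real k + 2 * pi * n < 2 * pi * real (i + 1) / real k)"
    unfolding unit_dir_eq_iff by blast
  also have "\<dots> \<longleftrightarrow> (\<exists>n::int. real i < x + real k * n \<and> x + real k * n < real i + 1)"
  proof (intro ex_cong1)
    fix n :: int
    have "2 * pi * x / real k + 2 * pi * n = 2 * pi * (x + real k * n) / real k"
      using assms(1) by (simp add: field_simps)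
    then show "(2 * pi * real i / real k < 2 * pi * x / real k + 2 * pi * n \<and>
        2 * pi * x / real k + 2 * pi * n < 2 * pi * real (i + 1) / real k)
        = (real i < x + real k * n \<and> x + real k * n < real i + 1)"
      using assms(1) by (simp add: divide_less_cancel add.commute)
  qed
  finally show ?thesis .
qed

section \<open>Upper bound: ordering by height\<close>

text \<open>A sector that meets the lower half-plane has to end beyond the angle \<open>pi\<close>.\<close>

lemma sector_below_index:
  assumes "q \<in> sector k i p" "q $ 2 < p $ 2" "i < k"
  shows "k div 2 \<le> i"
proof -
  obtain r \<theta> where r: "r > 0" and q: "q = p + r *\<^sub>R unit_dir \<theta>"
    and \<theta>: "2 * pi * real i / real k < \<theta>" "\<theta> < 2 * pi * real (i + 1) / real k"
    using assms(1) by (auto simp: sector_def)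
  have "0 \<le> 2 * pi * real i / real k" by simp
  with \<theta>(1) have "\<theta> > 0" by linarith
  moreover have "sin \<theta> < 0"
    using assms(2) r by (simp add: q mult_less_0_iff)
  ultimately have "pi < \<theta>"
    using sin_ge_zero[of \<theta>] by linarith
  then have "pi < 2 * pi * real (i + 1) / real k" using \<theta>(2) by linarith
  then have "pi * real k < pi * (2 * real (i + 1))"
    using assms(3) by (simp add: field_simps)
  then have "real k < real (2 * (i + 1))" by simp
  then have "k < 2 * (i + 1)" by (simp only: of_nat_less_iff)
  then show ?thesis by presburger
qed

lemma same_height_on_bounding_ray:
  assumes "p $ 2 = q $ 2" "p $ 1 \<le> q $ 1"
  shows "q \<in> bounding_ray k 0 p"
proof -
  have "q = p + (q $ 1 - p $ 1) *\<^sub>R unit_dir (2 * pi * real 0 / real k)"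
    using assms(1) by (simp add: vec_eq_iff forall_2)
  then show ?thesis
    using assms(2) by (force simp: bounding_ray_def)
qed

lemma general_position_heights:
  assumes "general_position k P" "k > 0" "p \<in> P" "q \<in> P" "p \<noteq> q"
  shows "p $ 2 \<noteq> q $ 2"
proof
  assume "p $ 2 = q $ 2"
  then have "q \<in> bounding_ray k 0 p \<or> p \<in> bounding_ray k 0 q"
    using same_height_on_bounding_ray[of p q] same_height_on_bounding_ray[of q p] by fastforce
  then show False
    using assms by (auto simp: general_position_def)
qed

lemma out_degree_le_of_sorted_by_height:
  assumes gp: "general_position k (set ps)" and "k > 0"
    and d: "distinct ps" and s: "sorted (map (\<lambda>p. p $ 2) ps)" and j: "j < length ps"
  shows "finite {q. (ps ! j, q) \<in> ordered_yao_graph k ps}"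
    and "card {q. (ps ! j, q) \<in> ordered_yao_graph k ps} \<le> k - k div 2"
proof -
  let ?N = "{q. (ps ! j, q) \<in> ordered_yao_graph k ps}"
  let ?closest = "\<lambda>i. is_arg_min (dist (ps ! j)) (\<lambda>x. x \<in> set (take j ps) \<inter> sector k i (ps ! j))"
  have N: "\<exists>i\<in>{k div 2..<k}. ?closest i q" if q: "q \<in> ?N" for q
  proof -
    obtain i where i: "i < k" "?closest i q"
      using q d j by (auto simp: ordered_yao_graph_def nth_eq_iff_index_eq)
    then have mem: "q \<in> set (take j ps)" "q \<in> sector k i (ps ! j)"
      by (auto simp: is_arg_min_def)
    then obtain l where l: "l < j" "q = ps ! l"
      by (auto simp: in_set_conv_nth)
    have "q $ 2 \<le> ps ! j $ 2"
      using sorted_nth_mono[OF s, of l j] l j by simp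
    moreover have "q $ 2 \<noteq> ps ! j $ 2"
      using general_position_heights[OF gp \<open>k > 0\<close>, of q "ps ! j"] l j d
      by (simp add: nth_eq_iff_index_eq)
    ultimately have "k div 2 \<le> i"
      using sector_below_index[OF mem(2)] i by simp
    with i show ?thesis by auto
  qed
  have sub: "?N \<subseteq> (\<lambda>i. THE q. ?closest i q) ` {k div 2..<k}"
  proof
    fix q assume "q \<in> ?N"
    then obtain i where i: "i \<in> {k div 2..<k}" "?closest i q" using N by blast
    have "set (take j ps) \<inter> sector k i (ps ! j) \<noteq> {}"
      using i(2) by (auto simp: is_arg_min_def)
    then have "\<exists>!q. ?closest i q"
      using ordered_yao_graph_unique[OF gp d j, of i] i(1) by simp
    then have "(THE q. ?closest i q) = q" using i(2) by (rule the1_equality)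
    with i(1) show "q \<in> (\<lambda>i. THE q. ?closest i q) ` {k div 2..<k}" by blast
  qed
  then show "finite ?N" by (rule finite_subset) simp
  have "card ?N \<le> card ((\<lambda>i. THE q. ?closest i q) ` {k div 2..<k})"
    using sub by (rule card_mono[rotated]) simp
  also have "\<dots> \<le> k - k div 2"
    using card_image_le[of "{k div 2..<k}" "\<lambda>i. THE q. ?closest i q"] by simp
  finally show "card ?N \<le> k - k div 2" .
qed

text \<open>Edges point backwards, so the last vertex of a clique is joined to all others by outgoing
  edges.\<close>

lemma clique_card_le_out_degree:
  assumes "clique (set ps) (ordered_yao_graph k ps) C" "distinct ps"
    and deg: "\<And>j. j < length ps \<Longrightarrow> finite {q. (ps ! j, q) \<in> ordered_yao_graph k ps}"
      "\<And>j. j < length ps \<Longrightarrow> card {q. (ps ! j, q) \<in> ordered_yao_graph k ps} \<le> d"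
  shows "card C \<le> d + 1"
proof (cases "C = {}")
  case False
  let ?E = "ordered_yao_graph k ps"
  define J where "J = {j. j < length ps \<and> ps ! j \<in> C}"
  have "C \<subseteq> set ps" using assms(1) by (simp add: clique_def)
  then have "J \<noteq> {}" using False by (force simp: J_def in_set_conv_nth)
  have "finite J" by (simp add: J_def)
  define j where "j = Max J"
  have j: "j < length ps" "ps ! j \<in> C"
    using Max_in[OF \<open>finite J\<close> \<open>J \<noteq> {}\<close>] by (simp_all add: j_def J_def)
  have "C \<subseteq> insert (ps ! j) {q. (ps ! j, q) \<in> ?E}"
  proof
    fix u assume u: "u \<in> C"
    then obtain l where l: "l < length ps" "u = ps ! l"
      using \<open>C \<subseteq> set ps\<close> by (metis in_set_conv_nth subsetD)
    have "l \<le> j"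
      using Max_ge[OF \<open>finite J\<close>, of l] l u by (simp add: j_def J_def)
    have "(u, ps ! j) \<notin> ?E"
    proof
      assume "(u, ps ! j) \<in> ?E"
      then have "ps ! j \<in> set (take l ps)"
        using l \<open>distinct ps\<close>
        by (auto simp: ordered_yao_graph_def is_arg_min_def nth_eq_iff_index_eq)
      then show False
        using \<open>l \<le> j\<close> j(1) l(1) \<open>distinct ps\<close>
        by (auto simp: in_set_conv_nth nth_eq_iff_index_eq)
    qed
    then show "u \<in> insert (ps ! j) {q. (ps ! j, q) \<in> ?E}"
      using assms(1) u j(2) by (auto simp: clique_def)
  qed
  then have "card C \<le> card (insert (ps ! j) {q. (ps ! j, q) \<in> ?E})"
    using deg(1)[OF j(1)] by (intro card_mono) auto
  also have "\<dots> \<le> Suc (card {q. (ps ! j, q) \<in> ?E})"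
    by (rule card_insert_le_m1) simp_all
  finally show ?thesis using deg(2)[OF j(1)] by simp
qed simp

lemma unavoidable_clique_size_le:
  assumes "k > 0" "finite P" "general_position k P" "unavoidable_clique_size k P m"
  shows "m \<le> k - k div 2 + 1"
proof -
  obtain xs where xs: "set xs = P" "distinct xs"
    using finite_distinct_list[OF assms(2)] by blast
  define ps where "ps = sort_key (\<lambda>p. p $ 2) xs"
  have ps: "set ps = P" "distinct ps" "sorted (map (\<lambda>p. p $ 2) ps)"
    using xs by (simp_all add: ps_def)
  then obtain C where "clique P (ordered_yao_graph k ps) C" "card C = m"
    using assms(4) by (auto simp: unavoidable_clique_size_def orders_def)
  then show ?thesis
    using clique_card_le_out_degree[of ps k C "k - k div 2"]
      out_degree_le_of_sorted_by_height[of k ps] assms(1,3) ps by simp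
qed

section \<open>Lower bound: alternate vertices of a regular polygon\<close>

definition sector_separated :: "nat \<Rightarrow> (real^2) set \<Rightarrow> bool" where
  "sector_separated k P \<longleftrightarrow>
     (\<forall>p\<in>P. \<forall>q\<in>P. p \<noteq> q \<longrightarrow> (\<exists>i<k. q \<in> sector k i p)) \<and>
     (\<forall>p\<in>P. \<forall>q\<in>P. \<forall>q'\<in>P. p \<noteq> q \<and> p \<noteq> q' \<and> q \<noteq> q' \<longrightarrow>
        (\<forall>i<k. \<not> (q \<in> sector k i p \<and> q' \<in> sector k i p)))"

lemma sector_separatedD:
  assumes "sector_separated k P" "p \<in> P" "q \<in> P" "q' \<in> P" "p \<noteq> q" "p \<noteq> q'"
    and "i < k" "q \<in> sector k i p" "q' \<in> sector k i p"
  shows "q = q'"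
proof (rule ccontr)
  assume "q \<noteq> q'"
  moreover have "p \<noteq> q \<and> p \<noteq> q' \<and> q \<noteq> q' \<longrightarrow>
      (\<forall>i<k. \<not> (q \<in> sector k i p \<and> q' \<in> sector k i p))"
    using assms(1)[unfolded sector_separated_def, THEN conjunct2, THEN bspec, OF assms(2),
      THEN bspec, OF assms(3), THEN bspec, OF assms(4)] .
  ultimately show False using assms(5-9) by simp
qed

lemma clique_if_separated:
  assumes "sector_separated k (set ps)" "distinct ps"
  shows "clique (set ps) (ordered_yao_graph k ps) (set ps)"
proof -
  let ?E = "ordered_yao_graph k ps"
  have edge: "(ps ! j, ps ! l) \<in> ?E" if lj: "l < j" "j < length ps" for j l
  proof -
    have ne: "ps ! j \<noteq> ps ! l'" if "l' < j" for l'
      using that lj(2) assms(2) by (simp add: nth_eq_iff_index_eq)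
    have mem: "ps ! j \<in> set ps" "ps ! l \<in> set ps" using lj by simp_all
    obtain i where i: "i < k" "ps ! l \<in> sector k i (ps ! j)"
      using assms(1) mem ne[OF lj(1)] unfolding sector_separated_def by blast
    have only: "x = ps ! l" if x: "x \<in> set (take j ps) \<inter> sector k i (ps ! j)" for x
    proof -
      obtain l' where l': "l' < j" "x = ps ! l'"
        using x lj(2) by (auto simp: in_set_conv_nth)
      then have "x \<in> set ps" "x \<noteq> ps ! j" using ne[of l'] lj by auto
      then show ?thesis
        using sector_separatedD[OF assms(1) mem(1), of x "ps ! l" i] i x mem(2) ne[OF lj(1)] by auto
    qed
    have "ps ! l \<in> set (take j ps)"
      using lj by (auto simp: in_set_conv_nth)
    then have "is_arg_min (dist (ps ! j)) (\<lambda>x. x \<in> set (take j ps) \<inter> sector k i (ps ! j)) (ps ! l)"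
      unfolding is_arg_min_def using i(2) only by (metis IntI less_irrefl)
    then show ?thesis
      using lj(2) i(1) unfolding ordered_yao_graph_def by blast
  qed
  show ?thesis
    unfolding clique_def
  proof (intro conjI ballI impI)
    fix u v assume "u \<in> set ps" "v \<in> set ps" "u \<noteq> v"
    then obtain j l where "j < length ps" "l < length ps" "u = ps ! j" "v = ps ! l" "j \<noteq> l"
      by (auto simp: in_set_conv_nth)
    then show "(u, v) \<in> ?E \<or> (v, u) \<in> ?E"
      using edge[of j l] edge[of l j] by (cases "j < l") auto
  qed simp
qed

lemma unavoidable_if_separated:
  assumes "sector_separated k P"
  shows "unavoidable_clique_size k P (card P)"
  unfolding unavoidable_clique_size_def orders_def
  using clique_if_separated assms by blast

text \<open>A chord of the unit circle is orthogonal to the bisector of its end points. The shift by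
  \<open>pi / 2\<close> compensates for this.\<close>

lemma unit_dir_chord:
  "unit_dir (\<beta> - pi / 2) - unit_dir (\<alpha> - pi / 2)
     = (2 * sin ((\<beta> - \<alpha>) / 2)) *\<^sub>R unit_dir ((\<alpha> + \<beta>) / 2)"
proof -
  have "cos ((\<alpha> + \<beta>) / 2) = cos ((\<beta> + \<alpha>) / 2)" by (simp add: add.commute)
  then show ?thesis
    using sin_diff_sin[of \<beta> \<alpha>] cos_diff_cos[of \<alpha> \<beta>]
    by (simp add: vec_eq_iff forall_2 sin_diff cos_diff)
qed

text \<open>A chord takes up half of the offset of each of its two ends, so the offset \<open>3 / 8\<close>, which is
  multiplied by two sector widths, turns all chords by three quarters of a sector width.\<close>

definition alternate_vertex :: "nat \<Rightarrow> nat \<Rightarrow> real^2" where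
  "alternate_vertex k a = unit_dir (4 * pi * (real a + 3 / 8) / real k - pi / 2)"

text \<open>The direction from vertex \<open>a\<close> to vertex \<open>b\<close>, in sector widths.\<close>

definition chord_pos :: "nat \<Rightarrow> nat \<Rightarrow> nat \<Rightarrow> real" where
  "chord_pos k a b = real a + real b + 3 / 4 + (if a < b then 0 else real k / 2)"

lemma alternate_vertex_chord:
  assumes "a < (k + 1) div 2" "b < (k + 1) div 2" "a \<noteq> b"
  obtains r where "r > 0"
    "alternate_vertex k b = alternate_vertex k a + r *\<^sub>R unit_dir (2 * pi * chord_pos k a b / real k)"
proof -
  have k: "k > 0" using assms by simp
  have pos: "sin (2 * pi * real d / real k) > 0" if "d > 0" "2 * d < k" for d
  proof (rule sin_gt_zero)
    show "0 < 2 * pi * real d / real k" using that by simp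
    have "pi * real (2 * d) < pi * real k" using that by (intro mult_strict_left_mono) auto
    then show "2 * pi * real d / real k < pi" using k by (simp add: field_simps)
  qed
  define \<phi> where "\<phi> = 2 * pi * (real a + real b + 3 / 4) / real k"
  have mid: "(4 * pi * (real a + 3 / 8) / real k + 4 * pi * (real b + 3 / 8) / real k) / 2 = \<phi>"
    using k by (simp add: \<phi>_def field_simps)
  have half: "(4 * pi * (real b + 3 / 8) / real k - 4 * pi * (real a + 3 / 8) / real k) / 2
      = 2 * pi * (real b - real a) / real k"
    using k by (simp add: field_simps)
  have chord: "alternate_vertex k b - alternate_vertex k a
      = (2 * sin (2 * pi * (real b - real a) / real k)) *\<^sub>R unit_dir \<phi>"
    using unit_dir_chord[of "4 * pi * (real b + 3 / 8) / real k" "4 * pi * (real a + 3 / 8) / real k"]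
    unfolding mid half by (simp add: alternate_vertex_def)
  show thesis
  proof (cases "a < b")
    case True
    then have "sin (2 * pi * (real b - real a) / real k) > 0"
      using pos[of "b - a"] assms by (simp add: of_nat_diff)
    moreover have "2 * pi * chord_pos k a b / real k = \<phi>"
      using True by (simp add: chord_pos_def \<phi>_def)
    ultimately show ?thesis
      using that[of "2 * sin (2 * pi * (real b - real a) / real k)"] chord
      by (simp add: algebra_simps)
  next
    case False
    define r where "r = 2 * sin (2 * pi * (real a - real b) / real k)"
    have "r > 0"
      using pos[of "a - b"] False assms by (simp add: r_def of_nat_diff)
    have "2 * pi * (real b - real a) / real k = - (2 * pi * (real a - real b) / real k)"
      using k by (simp add: field_simps)
    then have "2 * sin (2 * pi * (real b - real a) / real k) = - r"
      by (simp only: r_def sin_minus)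
    then have "alternate_vertex k b - alternate_vertex k a = r *\<^sub>R unit_dir (\<phi> + pi)"
      using chord by (simp add: unit_dir_add_pi)
    then have "alternate_vertex k b = alternate_vertex k a + r *\<^sub>R unit_dir (\<phi> + pi)"
      by (simp only: diff_eq_eq add.commute)
    moreover have "2 * pi * chord_pos k a b / real k = \<phi> + pi"
      using False k by (simp add: chord_pos_def \<phi>_def field_simps)
    ultimately show ?thesis
      using that[OF \<open>r > 0\<close>] by simp
  qed
qed

text \<open>Half a turn is \<open>k / 2\<close> sector widths, which is \<open>m\<close> or \<open>m - 1 / 2\<close> for \<open>m = (k + 1) div 2\<close>.
  Since the fractional part is \<open>3 / 4\<close> before the half turn, it is \<open>3 / 4\<close> or \<open>1 / 4\<close> afterwards,
  and in both cases the turn advances the integer part by \<open>m\<close>.\<close>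

lemma chord_pos_floor:
  obtains f where "f = 1 / 4 \<or> f = (3 / 4 :: real)"
    "chord_pos k a b = real (a + b + (if a < b then 0 else (k + 1) div 2)) + f"
proof (cases "a < b \<or> even k")
  case True
  then show ?thesis using that[of "3 / 4"] by (auto simp: chord_pos_def elim!: evenE)
next
  case False
  then show ?thesis using that[of "1 / 4"] by (auto simp: chord_pos_def field_simps elim!: oddE)
qed

lemma chord_not_on_ray: "real i \<noteq> chord_pos k a b + real k * real_of_int n"
proof
  assume eq: "real i = chord_pos k a b + real k * real_of_int n"
  obtain f t where f: "f = 1 / 4 \<or> f = (3 / 4 :: real)" "chord_pos k a b = real t + f"
    by (rule chord_pos_floor)
  define z where "z = int i - int t - int k * n"
  have "f = real_of_int z" using eq f(2) by (simp add: z_def)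
  then have "real_of_int (4 * z) = 1 \<or> real_of_int (4 * z) = 3" using f(1) by auto
  then have "4 * z = 1 \<or> 4 * z = 3" by linarith
  then show False by presburger
qed

text \<open>Going round from vertex \<open>a\<close>, the integer parts of the positions of the other vertices form a
  strictly increasing sequence inside a window shorter than \<open>k\<close>.\<close>

lemma chord_sectors_distinct:
  assumes "a < (k + 1) div 2" "b < (k + 1) div 2" "c < (k + 1) div 2" "a \<noteq> b" "a \<noteq> c"
    and "real i < chord_pos k a b + real k * real_of_int n"
      "chord_pos k a b + real k * real_of_int n < real i + 1"
    and "real i < chord_pos k a c + real k * real_of_int n'"
      "chord_pos k a c + real k * real_of_int n' < real i + 1"
  shows "b = c"
proof -
  define m where "m = (k + 1) div 2"
  define t where "t x = x + (if a < x then 0 else m)" for x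
  have int_part: "int i = int (a + t x) + int k * l"
    if "real i < chord_pos k a x + real k * real_of_int l"
      "chord_pos k a x + real k * real_of_int l < real i + 1" for x l
  proof -
    obtain f where f: "f = 1 / 4 \<or> f = (3 / 4 :: real)" "chord_pos k a x = real (a + t x) + f"
      unfolding t_def m_def add.assoc[symmetric] by (rule chord_pos_floor)
    define z where "z = int (a + t x) + int k * l"
    have "chord_pos k a x + real k * real_of_int l = real_of_int z + f"
      by (simp add: f z_def)
    then have "real_of_int (int i) < real_of_int z + f" "real_of_int z + f < real_of_int (int i) + 1"
      using that by simp_all
    then have "int i = z" using f(1) by linarith
    then show ?thesis by (simp add: z_def)
  qed
  have "int (a + t b) + int k * n = int (a + t c) + int k * n'"
    using int_part[OF assms(6,7)] int_part[OF assms(8,9)] by simp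
  then have "int (t b) - int (t c) = int k * (n' - n)"
    by (simp add: algebra_simps)
  then have dvd: "int k dvd int (t b) - int (t c)" by simp
  have window: "a < t x \<and> t x < a + m" if "x < m" "a \<noteq> x" for x
    using that assms(1) by (auto simp: t_def m_def)
  have "m \<le> k" using assms(1) by (simp add: m_def)
  then have "\<bar>int (t b) - int (t c)\<bar> < int k"
    using window[of b] window[of c] assms(2-5) unfolding m_def[symmetric] by linarith
  then have "t b = t c"
    using dvd zdvd_not_zless[of "\<bar>int (t b) - int (t c)\<bar>" "int k"] by auto
  then show ?thesis
    using assms(2,3) by (auto simp: t_def m_def split: if_splits)
qed

lemma alternate_vertices_separated:
  fixes k :: nat
  defines "P \<equiv> alternate_vertex k ` {..<(k + 1) div 2}"
  assumes "k > 0"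
  shows "card P = (k + 1) div 2" "sector_separated k P" "general_position k P"
proof -
  let ?v = "alternate_vertex k" and ?m = "(k + 1) div 2"
  have ne: "?v a \<noteq> ?v b" if ab: "a < ?m" "b < ?m" "a \<noteq> b" for a b
  proof -
    obtain r where "r > 0" and v: "?v b = ?v a + r *\<^sub>R unit_dir (2 * pi * chord_pos k a b / real k)"
      by (rule alternate_vertex_chord[OF ab])
    moreover have "norm (r *\<^sub>R unit_dir (2 * pi * chord_pos k a b / real k)) = \<bar>r\<bar>" by simp
    ultimately show ?thesis by (metis add_cancel_left_right abs_0_eq norm_zero less_irrefl)
  qed
  then have "inj_on ?v {..<?m}" by (auto simp: inj_on_def)
  then show "card P = ?m" by (simp add: P_def card_image)
  have ray: "?v b \<notin> bounding_ray k i (?v a)" if ab: "a < ?m" "b < ?m" "a \<noteq> b" for a b i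
  proof -
    obtain r where r: "r > 0" "?v b = ?v a + r *\<^sub>R unit_dir (2 * pi * chord_pos k a b / real k)"
      by (rule alternate_vertex_chord[OF ab])
    show ?thesis
      using mem_bounding_ray_iff[OF \<open>k > 0\<close> r(1)] r(2) chord_not_on_ray by simp
  qed
  have sector: "?v b \<in> sector k i (?v a) \<longleftrightarrow>
      (\<exists>n::int. real i < chord_pos k a b + real k * n \<and> chord_pos k a b + real k * n < real i + 1)"
    if ab: "a < ?m" "b < ?m" "a \<noteq> b" for a b i
  proof -
    obtain r where r: "r > 0" "?v b = ?v a + r *\<^sub>R unit_dir (2 * pi * chord_pos k a b / real k)"
      by (rule alternate_vertex_chord[OF ab])
    show ?thesis
      using mem_sector_iff[OF \<open>k > 0\<close> r(1)] r(2) by simp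
  qed
  have hit: "\<exists>i<k. ?v b \<in> sector k i (?v a)" if ab: "a < ?m" "b < ?m" "a \<noteq> b" for a b
  proof -
    obtain f t where f: "f = 1 / 4 \<or> f = (3 / 4 :: real)" "chord_pos k a b = real t + f"
      by (rule chord_pos_floor)
    have "real t = real (t mod k) + real k * real (t div k)"
      by (metis mod_mult_div_eq of_nat_add of_nat_mult)
    then have "chord_pos k a b + real k * real_of_int (- int (t div k)) = real (t mod k) + f"
      using f(2) by simp
    then have "?v b \<in> sector k (t mod k) (?v a)"
      unfolding sector[OF ab] using f(1) by (intro exI[of _ "- int (t div k)"]) auto
    then show ?thesis using \<open>k > 0\<close> by (intro exI[of _ "t mod k"]) simp
  qed
  have diff: "\<not> (?v b \<in> sector k i (?v a) \<and> ?v c \<in> sector k i (?v a))"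
    if "a < ?m" "b < ?m" "c < ?m" "a \<noteq> b" "a \<noteq> c" "b \<noteq> c" for a b c i
    using that sector[of a b i] sector[of a c i] chord_sectors_distinct[of a k b c i] by blast
  show sep: "sector_separated k P"
    unfolding sector_separated_def
  proof (intro conjI ballI impI)
    fix p q assume "p \<in> P" "q \<in> P" "p \<noteq> q"
    then show "\<exists>i<k. q \<in> sector k i p" using hit by (auto simp: P_def)
  next
    fix p q q' assume "p \<in> P" "q \<in> P" "q' \<in> P" "p \<noteq> q \<and> p \<noteq> q' \<and> q \<noteq> q'"
    then obtain a b c where abc: "p = ?v a" "q = ?v b" "q' = ?v c" "a < ?m" "b < ?m" "c < ?m"
      "a \<noteq> b" "a \<noteq> c" "b \<noteq> c"
      by (auto simp: P_def)
    show "\<forall>i<k. \<not> (q \<in> sector k i p \<and> q' \<in> sector k i p)"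
      unfolding abc(1-3) using diff[OF abc(4-9)] by blast
  qed
  show "general_position k P"
    unfolding general_position_def
  proof (intro conjI ballI impI)
    fix p q assume "p \<in> P" "q \<in> P" "p \<noteq> q"
    then show "\<forall>i<k. q \<notin> bounding_ray k i p" using ray by (auto simp: P_def)
  next
    fix p q q' assume "p \<in> P" "q \<in> P" "q' \<in> P" "p \<noteq> q \<and> p \<noteq> q' \<and> q \<noteq> q'"
    then show "\<forall>i<k. q \<in> sector k i p \<and> q' \<in> sector k i p \<longrightarrow> dist p q \<noteq> dist p q'"
      using sector_separatedD[OF sep, of p q q'] by blast
  qed
qed

section \<open>The clique number\<close>

lemma yao_w_n_le:
  assumes "k > 0"
  shows "yao_w_n k n \<le> k - k div 2 + 1"
proof -
  have "yao_w_n k n \<in> yao_w_sizes k n"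
    unfolding yao_w_n_def using yao_w_sizes_finite_nonempty[of k n] assms by (intro Max_in) auto
  then show ?thesis
    using unavoidable_clique_size_le[OF assms] by (auto simp: yao_w_sizes_def)
qed

lemma yao_w_n_ge:
  assumes "k > 0"
  shows "(k + 1) div 2 \<le> yao_w_n k ((k + 1) div 2)"
proof -
  define P where "P = alternate_vertex k ` {..<(k + 1) div 2}"
  have P: "finite P" "card P = (k + 1) div 2" "general_position k P" "sector_separated k P"
    using alternate_vertices_separated[OF assms] by (simp_all add: P_def)
  then have "unavoidable_clique_size k P ((k + 1) div 2)"
    using unavoidable_if_separated[OF P(4)] by simp
  then have "(k + 1) div 2 \<in> yao_w_sizes k ((k + 1) div 2)"
    unfolding yao_w_sizes_def using P by blast
  then show ?thesis
    unfolding yao_w_n_def using yao_w_sizes_finite_nonempty(1)[of k] assms by (intro Max_ge) auto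
qed

theorem theorem5:
  fixes k :: nat
  assumes "k \<ge> 2"
  shows "finite (range (yao_w_n k)) \<and>
         \<lceil>real k / 2\<rceil> \<le> int (yao_w k) \<and> int (yao_w k) \<le> \<lceil>real k / 2\<rceil> + 1"
proof -
  have k: "k > 0" using assms by simp
  have ceil: "\<lceil>real k / 2\<rceil> = int ((k + 1) div 2)"
    by (rule ceiling_unique) (cases "even k"; auto elim!: evenE oddE)+
  have fin: "finite (range (yao_w_n k))"
  proof (rule finite_subset)
    show "range (yao_w_n k) \<subseteq> {..k - k div 2 + 1}"
      using yao_w_n_le[OF k] by blast
  qed simp
  have "(k + 1) div 2 \<le> yao_w k"
    unfolding yao_w_def using order_trans[OF yao_w_n_ge[OF k] Max_ge[OF fin rangeI]] .
  moreover have "yao_w k \<le> k - k div 2 + 1"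
    unfolding yao_w_def by (rule Max.boundedI[OF fin]) (use yao_w_n_le[OF k] in blast)+
  moreover have "k - k div 2 = (k + 1) div 2" by presburger
  ultimately show ?thesis unfolding ceil using fin by simp
qed

end
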